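(* Let $f,g\in G_3$. Then there exists a closed set $F\subseteq\mathbb{R}$ which is right-$[g]$-porous and is not $\sigma$-left-$[f]$-porous.
   Context: $G$ denotes the set of all increasing continuous functions $f:[0,\delta)\to[0,\infty)$ (where $\delta>0$ may depend on $f$) with $f(0)=0$. $G_3$ denotes the set of all $f\in G$ such that $f(x)<x$ for each $x\neq 0$ from the domain of $f$. (Increasing means strictly increasing, decreasing means strictly decreasing.) Let $M\subseteq\mathbb{R}$, $x\in\mathbb{R}$ and $g\in G_3$. The set $M$ is right-$[g]$-porous at $x$ if there exists a decreasing sequence $\{\alpha_n\}_{n=1}^\infty$ of real numbers (lying in the domain of $g$) tending to $0$ such that $(x+g(\alpha_n),x+\alpha_n)\cap M=\emptyset$ for each $n\in\mathbb{N}$. Symmetrically, $M$ is left-$[g]$-porous at $x$ if there exists a decreasing sequence $\{\alpha_n\}_{n=1}^\infty$ of real numbers (lying in the domain of $g$) tending to $0$ such that $(x-\alpha_n,x-g(\alpha_n))\cap M=\emptyset$ for each $n\in\mathbb{N}$. The set $M$ is right-$[g]$-porous (resp. left-$[g]$-porous) if it is right-$[g]$-porous (resp. left-$[g]$-porous) at each of its points. The set $M$ is $\sigma$-left-$[g]$-porous if it is a countable union of left-$[g]$-porous sets. *)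

theory Defs
  imports "HOL-Analysis.Analysis"
begin

text \<open>
  A function with domain \<open>[0, \<delta>)\<close> is encoded as a total function together with the
  number \<open>\<delta>\<close>; only its values on \<open>{0..<\<delta>}\<close> matter.
\<close>

definition G :: "real \<Rightarrow> (real \<Rightarrow> real) \<Rightarrow> bool" where
  "G \<delta> f \<longleftrightarrow> 0 < \<delta> \<and> f \<in> {0..<\<delta>} \<rightarrow> {0..} \<and> strict_mono_on {0..<\<delta>} f \<and>
     continuous_on {0..<\<delta>} f \<and> f 0 = 0"

definition G3 :: "real \<Rightarrow> (real \<Rightarrow> real) \<Rightarrow> bool" where
  "G3 \<delta> f \<longleftrightarrow> G \<delta> f \<and> (\<forall>x\<in>{0..<\<delta>}. x \<noteq> 0 \<longrightarrow> f x < x)"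

definition right_porous_at :: "real \<Rightarrow> (real \<Rightarrow> real) \<Rightarrow> real set \<Rightarrow> real \<Rightarrow> bool" where
  "right_porous_at \<delta> g M x \<longleftrightarrow>
     (\<exists>\<alpha> :: nat \<Rightarrow> real. strict_antimono_on UNIV \<alpha> \<and> range \<alpha> \<subseteq> {0..<\<delta>} \<and> \<alpha> \<longlonglongrightarrow> 0 \<and>
        (\<forall>n. {x + g (\<alpha> n)<..<x + \<alpha> n} \<inter> M = {}))"

definition left_porous_at :: "real \<Rightarrow> (real \<Rightarrow> real) \<Rightarrow> real set \<Rightarrow> real \<Rightarrow> bool" where
  "left_porous_at \<delta> g M x \<longleftrightarrow>
     (\<exists>\<alpha> :: nat \<Rightarrow> real. strict_antimono_on UNIV \<alpha> \<and> range \<alpha> \<subseteq> {0..<\<delta>} \<and> \<alpha> \<longlonglongrightarrow> 0 \<and>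
        (\<forall>n. {x - \<alpha> n<..<x - g (\<alpha> n)} \<inter> M = {}))"

definition right_porous :: "real \<Rightarrow> (real \<Rightarrow> real) \<Rightarrow> real set \<Rightarrow> bool" where
  "right_porous \<delta> g M \<longleftrightarrow> (\<forall>x\<in>M. right_porous_at \<delta> g M x)"

definition left_porous :: "real \<Rightarrow> (real \<Rightarrow> real) \<Rightarrow> real set \<Rightarrow> bool" where
  "left_porous \<delta> g M \<longleftrightarrow> (\<forall>x\<in>M. left_porous_at \<delta> g M x)"

definition sigma_left_porous :: "real \<Rightarrow> (real \<Rightarrow> real) \<Rightarrow> real set \<Rightarrow> bool" where
  "sigma_left_porous \<delta> g M \<longleftrightarrow>
     (\<exists>\<A>. countable \<A> \<and> (\<forall>A\<in>\<A>. left_porous \<delta> g A) \<and> M = \<Union>\<A>)"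

end

theory Submission
  imports Defs
begin

text \<open>
  \<open>F\<close> is a Cantor set given by a tree of intervals \<open>[pos, pos + sz wid]\<close> with
  \<open>sz w = g (w / 2)\<close>. The rest of \<open>[pos, pos + wid)\<close> stays free of \<open>F\<close>, which makes \<open>F\<close>
  right-porous. The children of a node carry ranks, and to the left of a child \<open>C\<close> there is, for
  every \<open>m < rank C\<close>, a chain of children of rank \<open>m\<close> that leads from near the left end of the
  parent to near \<open>C\<close> in jumps so short, compared with the distance to \<open>C\<close>, that a set meeting
  every link of the chain has no \<open>f\<close>-gap there.

  Given \<open>F = (\<Union>n. A n)\<close>, descend through the tree as in Foran's category argument. At stage \<open>n\<close>,
  if some node reachable through ranks \<open>\<ge> n\<close> misses \<open>A n\<close>, move there. Otherwise use only
  ranks \<open>> n\<close> from then on: all chains of rank \<open>n\<close> met on the way have links meeting \<open>A n\<close>, so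
  \<open>A n\<close> is not left-porous at the limit point. Hence the limit point lies in no left-porous \<open>A n\<close>.
\<close>

datatype node = Node (pos: real) (wid: real) (rank: nat)

text \<open>
  The number \<open>\<eta> q\<close> will be a lower bound for the length \<open>y - f y\<close> of an \<open>f\<close>-gap whose far end
  is at a distance \<open>y \<ge> q\<close>.
\<close>

locale hopping =
  fixes \<eta> sz :: "real \<Rightarrow> real"
  assumes \<eta>_pos: "0 < q \<Longrightarrow> 0 < \<eta> q"
    and \<eta>_mono: "0 < q \<Longrightarrow> q \<le> q' \<Longrightarrow> \<eta> q \<le> \<eta> q'"
    and sz_pos: "0 < w \<Longrightarrow> 0 < sz w"
    and sz_less: "0 < w \<Longrightarrow> sz w < w / 2"
begin

section \<open>Hops, chains and the insertion of one more rank\<close>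

text \<open>
  If \<open>d\<close> is the distance to the target, a jump of length at most \<open>2 * \<theta> d\<close> that leaves a
  distance of at least \<open>d / 2\<close> is short enough.
\<close>

definition \<theta> :: "real \<Rightarrow> real" where
  "\<theta> x = min (x / 4) (\<eta> (x / 2) / 2)"

lemma \<theta>_pos: "0 < x \<Longrightarrow> 0 < \<theta> x"
  using \<eta>_pos[of "x/2"] by (simp add: \<theta>_def)

lemma \<theta>_le: "\<theta> x \<le> x / 4" "2 * \<theta> x \<le> \<eta> (x / 2)"
  by (auto simp: \<theta>_def min_def)

lemma \<theta>_mono: "0 < x \<Longrightarrow> x \<le> y \<Longrightarrow> \<theta> x \<le> \<theta> y"
  using \<eta>_mono[of "x/2" "y/2"] by (auto simp: \<theta>_def min_def)

lemma funpow_\<theta>_pos: "0 < x \<Longrightarrow> 0 < (\<theta> ^^ j) x"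
  by (induction j) (auto intro: \<theta>_pos)

lemma funpow_\<theta>_mono: "0 < x \<Longrightarrow> x \<le> y \<Longrightarrow> (\<theta> ^^ j) x \<le> (\<theta> ^^ j) y"
  by (induction j) (auto intro: \<theta>_mono funpow_\<theta>_pos)

lemma funpow_\<theta>_le: "0 < x \<Longrightarrow> (\<theta> ^^ j) x \<le> x"
proof (induction j)
  case (Suc j)
  then show ?case
    using \<theta>_le(1)[of "(\<theta> ^^ j) x"] funpow_\<theta>_pos[of x j] by simp
qed simp

text \<open>The length is taken from the left end of \<open>p\<close> to the right end of
  \<open>q\<close>, the worst case, so that any choice of points in the two intervals gives a
  \<open>jump\<close>.\<close>

definition hop :: "real \<Rightarrow> node \<Rightarrow> node \<Rightarrow> bool" where
  "hop v p q \<longleftrightarrow> 0 < v - (pos q + sz (wid q)) \<and>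
     pos q + sz (wid q) - pos p < \<eta> (v - (pos q + sz (wid q)))"

abbreviation chain :: "node set \<Rightarrow> nat \<Rightarrow> real \<Rightarrow> node \<Rightarrow> node \<Rightarrow> bool" where
  "chain V m v \<equiv> (\<lambda>p q. q \<in> V \<and> rank q = m \<and> hop v p q)\<^sup>*\<^sup>*"

text \<open>The origin is the left end of the parent. The bound on the first link lets a point just
  left of the origin jump to it; the bound on the last link, later \<open>slack\<close>, prepares
  the jump into \<open>C\<close>.\<close>

definition linked :: "(real \<Rightarrow> real) \<Rightarrow> node set \<Rightarrow> node \<Rightarrow> nat \<Rightarrow> bool" where
  "linked \<kappa> V C m \<longleftrightarrow> (\<exists>p q. p \<in> V \<and> rank p = m \<and> pos p + sz (wid p) \<le> \<theta> (pos C) \<and>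
     chain V m (pos C) p q \<and> pos C - pos q < \<kappa> (wid C))"

lemma linked_mono:
  assumes "linked \<kappa> V C m" "V \<subseteq> V'"
  shows "linked \<kappa> V' C m"
proof -
  have "chain V m v p q \<Longrightarrow> chain V' m v p q" for v p q
    by (rule rtranclp_mono[THEN predicate2D, rotated]) (use assms(2) in auto)
  with assms show ?thesis unfolding linked_def by blast
qed

text \<open>The exponent \<open>j\<close> counts the refinements still affordable;
  \<open>j = 0\<close> leaves disjointness and the width bound 1.\<close>

definition spaced :: "nat \<Rightarrow> node set \<Rightarrow> bool" where
  "spaced j V \<longleftrightarrow> finite V \<and> inj_on pos V \<and> (\<forall>p\<in>V. 0 < wid p \<and> wid p \<le> (\<theta> ^^ j) 1) \<and>
     (\<forall>p\<in>V. \<forall>q\<in>V. pos p < pos q \<longrightarrow> wid p \<le> (\<theta> ^^ j) (pos q - pos p))"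

text \<open>
  Fill a fine grid of mesh \<open>h\<close> with nodes of rank \<open>m\<close>, leaving out a neighbourhood of each old
  node \<open>p\<close> that reaches \<open>\<Lambda> p\<close> to its right. Jumping over this neighbourhood on the way to an old
  node \<open>C\<close> is allowed since \<open>\<Lambda> p \<le> \<theta> (pos C - pos p)\<close>, and \<open>wid p\<close> fits into it since
  \<open>wid p \<le> (\<theta> ^^ Suc j) (pos q - pos p)\<close> for old \<open>q\<close>; this costs one power of \<open>\<theta>\<close>.
\<close>

lemma refine:
  assumes V: "spaced (Suc j) V" "V \<noteq> {}"
    and c: "0 < c" "\<And>p. p \<in> V \<Longrightarrow> c \<le> pos p" and b: "\<And>p. p \<in> V \<Longrightarrow> pos p \<le> b"
    and \<kappa>: "\<And>w. 0 < w \<Longrightarrow> 0 < \<kappa> w" and M: "0 < M"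
  shows "\<exists>V'. V \<subseteq> V' \<and> spaced j V' \<and>
    (\<forall>p\<in>V' - V. rank p = m \<and> \<theta> c / 2 \<le> pos p \<and> pos p \<le> b \<and> wid p \<le> M) \<and>
    (\<forall>C\<in>V. linked \<kappa> V' C m)"
proof -
  have fin: "finite V" and inj: "inj_on pos V" and wid: "\<And>p. p \<in> V \<Longrightarrow> 0 < wid p"
    and wid1: "\<And>p. p \<in> V \<Longrightarrow> wid p \<le> (\<theta> ^^ Suc j) 1"
    and sp: "\<And>p q. p \<in> V \<Longrightarrow> q \<in> V \<Longrightarrow> pos p < pos q \<Longrightarrow> wid p \<le> (\<theta> ^^ Suc j) (pos q - pos p)"
    using V(1) unfolding spaced_def by auto
  \<comment> \<open>The element 1 keeps \<open>D p\<close> nonempty for the rightmost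
    \<open>p\<close> and is matched by the bound \<open>(\<theta> ^^ Suc j) 1\<close> on
    widths.\<close>
  define D where "D p = insert 1 ((\<lambda>q. pos q - pos p) ` {q \<in> V. pos p < pos q})" for p
  define \<Lambda> where "\<Lambda> p = \<theta> (Min (D p))" for p
  have finD: "finite (D p)" "D p \<noteq> {}" for p
    using fin by (auto simp: D_def)
  have MinD_pos: "0 < Min (D p)" for p
    using finD[of p] by (subst Min_gr_iff) (auto simp: D_def)
  have \<Lambda>_pos: "0 < \<Lambda> p" for p
    unfolding \<Lambda>_def by (rule \<theta>_pos[OF MinD_pos])
  have MinD_le: "Min (D p) \<le> pos q - pos p" if "q \<in> V" "pos p < pos q" for p q
    by (rule Min_le[OF finD(1)]) (use that in \<open>auto simp: D_def\<close>)
  have \<Lambda>_le: "\<Lambda> p \<le> \<theta> (pos q - pos p)" if "q \<in> V" "pos p < pos q" for p q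
    unfolding \<Lambda>_def by (rule \<theta>_mono[OF MinD_pos MinD_le[OF that]])
  \<comment> \<open>All scales the mesh must resolve: the start of the grid, the target accuracies,
    the gaps between old nodes.\<close>
  define H where "H = insert (\<theta> c) ((\<lambda>p. \<theta> (\<kappa> (wid p))) ` V \<union>
      (\<lambda>(p, q). \<theta> (pos q - pos p)) ` {(p, q). p \<in> V \<and> q \<in> V \<and> pos p < pos q})"
  have "finite {(p, q). p \<in> V \<and> q \<in> V \<and> pos p < pos q}"
    by (rule finite_subset[of _ "V \<times> V"]) (use fin in auto)
  then have finH: "finite H" "H \<noteq> {}"
    using fin by (auto simp: H_def)
  define h where "h = Min H / 4"
  have "0 < Min H"
    using finH by (subst Min_gr_iff) (auto simp: H_def intro!: \<theta>_pos c(1) \<kappa> wid)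
  then have h: "0 < h" by (simp add: h_def)
  have hH: "4 * h \<le> y" if "y \<in> H" for y
    using Min_le[OF finH(1) that] by (simp add: h_def)
  have h_c: "4 * h \<le> \<theta> c" by (rule hH) (simp add: H_def)
  have h_\<kappa>: "4 * h \<le> \<theta> (\<kappa> (wid p))" if "p \<in> V" for p
    by (rule hH) (use that in \<open>auto simp: H_def\<close>)
  have h_d: "4 * h \<le> \<theta> (pos q - pos p)" if "p \<in> V" "q \<in> V" "pos p < pos q" for p q
    by (rule hH) (use that in \<open>auto simp: H_def\<close>)
  \<comment> \<open>Half of \<open>\<theta> c\<close> leaves room for \<open>sz W\<close>, so the
    first link ends before \<open>\<theta> (pos C)\<close>.\<close>
  define c0 where "c0 = \<theta> c / 2"
  \<comment> \<open>A new node is at least \<open>h / 2\<close> away from the next node to its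
    right.\<close>
  define W where "W = min M (min ((\<theta> ^^ j) 1) ((\<theta> ^^ j) (h / 2)))"
  have W: "0 < W" "W \<le> M" "W \<le> (\<theta> ^^ j) (h / 2)" "W \<le> (\<theta> ^^ j) 1"
    using M funpow_\<theta>_pos[of "h/2" j] funpow_\<theta>_pos[of 1 j] h by (auto simp: W_def)
  have W_h: "W \<le> h / 2"
    using W(3) funpow_\<theta>_le[of "h/2" j] h by simp
  have szW: "0 < sz W" "sz W < h / 4"
    using sz_pos[OF W(1)] sz_less[OF W(1)] W_h by auto
  define good where "good x \<longleftrightarrow> (\<exists>i::nat. x = c0 + of_nat i * h) \<and> x \<le> b \<and>
    (\<forall>p\<in>V. x < pos p - h / 2 \<or> pos p + \<Lambda> p < x)" for x
  have good_ge: "c0 \<le> x" if "good x" for x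
    using that h by (auto simp: good_def)
  have good_sep: "x + h \<le> y" if "good x" "good y" "x < y" for x y
  proof -
    from that obtain i k :: nat where ik: "x = c0 + of_nat i * h" "y = c0 + of_nat k * h"
      unfolding good_def by blast
    with \<open>x < y\<close> h have "i < k" by simp
    then have "(of_nat i + 1) * h \<le> of_nat k * h"
      using h by (intro mult_right_mono) auto
    with ik show ?thesis by (simp add: algebra_simps)
  qed
  have fin_good: "finite {x. good x}"
  proof (rule finite_subset)
    show "{x. good x} \<subseteq> (\<lambda>i::nat. c0 + of_nat i * h) ` {..nat \<lceil>(b - c0) / h\<rceil>}"
    proof
      fix x assume "x \<in> {x. good x}"
      then obtain i :: nat where i: "x = c0 + of_nat i * h" "x \<le> b"
        unfolding good_def by blast
      then have "real i \<le> (b - c0) / h" using h by (simp add: field_simps)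
      then have "i \<le> nat \<lceil>(b - c0) / h\<rceil>" by linarith
      with i show "x \<in> (\<lambda>i::nat. c0 + of_nat i * h) ` {..nat \<lceil>(b - c0) / h\<rceil>}" by blast
    qed
  qed simp
  define V' where "V' = V \<union> (\<lambda>x. Node x W m) ` {x. good x}"
  have not_good: "\<not> good (pos p)" if "p \<in> V" for p
  proof
    assume "good (pos p)"
    then have "pos p < pos p - h / 2 \<or> pos p + \<Lambda> p < pos p"
      using that unfolding good_def by blast
    with h \<Lambda>_pos[of p] show False by linarith
  qed
  have "spaced j V'"
    unfolding spaced_def
  proof (intro conjI ballI impI)
    show "finite V'" using fin fin_good by (simp add: V'_def)
    show "inj_on pos V'"
      using inj not_good unfolding V'_def inj_on_def by (force)
    show "0 < wid p" if "p \<in> V'" for p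
      using that wid W(1) by (auto simp: V'_def)
    have "(\<theta> ^^ j) (\<theta> 1) \<le> (\<theta> ^^ j) 1"
      using \<theta>_le(1)[of 1] by (intro funpow_\<theta>_mono \<theta>_pos) auto
    then show "wid p \<le> (\<theta> ^^ j) 1" if "p \<in> V'" for p
      using that wid1[of p] W(4) by (auto simp: V'_def funpow_swap1)
    fix p q assume pq: "p \<in> V'" "q \<in> V'" "pos p < pos q"
    consider "p \<in> V" "q \<in> V" | "p \<in> V" "good (pos q)" | "good (pos p)" "q \<in> V" "p = Node (pos p) W m"
      | "good (pos p)" "good (pos q)" "p = Node (pos p) W m"
      using pq(1,2) unfolding V'_def by fastforce
    then show "wid p \<le> (\<theta> ^^ j) (pos q - pos p)"
    proof cases
      case 1
      have "(\<theta> ^^ j) (\<theta> (pos q - pos p)) \<le> (\<theta> ^^ j) (pos q - pos p)"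
        using \<theta>_le(1)[of "pos q - pos p"] pq(3)
        by (intro funpow_\<theta>_mono \<theta>_pos) auto
      with sp[OF 1 pq(3)] show ?thesis by (simp add: funpow_swap1)
    next
      case 2
      have "pos p + \<Lambda> p < pos q"
        using 2 pq(3) h unfolding good_def by fastforce
      then have "(\<theta> ^^ j) (\<Lambda> p) \<le> (\<theta> ^^ j) (pos q - pos p)"
        by (intro funpow_\<theta>_mono \<Lambda>_pos) auto
      moreover have "wid p \<le> (\<theta> ^^ j) (\<Lambda> p)"
      proof -
        have "Min (D p) \<in> D p" by (rule Min_in[OF finD])
        then have "wid p \<le> (\<theta> ^^ Suc j) (Min (D p))"
          using wid1[OF 2(1)] sp[OF 2(1)] unfolding D_def[of p] by auto
        then show ?thesis by (simp add: \<Lambda>_def funpow_swap1)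
      qed
      ultimately show ?thesis by simp
    next
      case 3
      have "pos p < pos q - h / 2"
        using 3 pq(3) \<Lambda>_pos[of q] unfolding good_def by fastforce
      then have "(\<theta> ^^ j) (h / 2) \<le> (\<theta> ^^ j) (pos q - pos p)"
        using h by (intro funpow_\<theta>_mono) auto
      moreover have "wid p = W" by (subst 3(3)) simp
      ultimately show ?thesis using W(3) by simp
    next
      case 4
      have "(\<theta> ^^ j) (h / 2) \<le> (\<theta> ^^ j) (pos q - pos p)"
        using h good_sep[OF 4(1,2) pq(3)] by (intro funpow_\<theta>_mono) auto
      moreover have "wid p = W" by (subst 4(3)) simp
      ultimately show ?thesis using W(3) by simp
    qed
  qed
  moreover have "linked \<kappa> V' C m" if C: "C \<in> V" for C
  proof -
    define v where "v = pos C"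
    define K where "K = \<kappa> (wid C)"
    have K: "0 < K" "4 * h \<le> \<theta> K"
      using \<kappa>[OF wid[OF C]] h_\<kappa>[OF C] by (auto simp: K_def)
    have v: "c \<le> v" "v \<le> b" using c(2)[OF C] b[OF C] by (auto simp: v_def)
    have c0: "0 < c0" "c0 \<le> c / 8" "h \<le> c / 16" "2 * h \<le> c0"
      using \<theta>_pos[OF c(1)] \<theta>_le(1)[of c] h_c by (auto simp: c0_def)
    have "good c0"
      unfolding good_def
    proof (intro conjI ballI disjI1)
      show "\<exists>i::nat. c0 = c0 + of_nat i * h" by (rule exI[of _ 0]) simp
      show "c0 \<le> b" using c0 v c(1) by linarith
      show "c0 < pos p - h / 2" if "p \<in> V" for p
        using c(2)[OF that] c0 c(1) by linarith
    qed
    define X where "X = {x. good x \<and> x < v \<and> chain V' m v (Node c0 W m) (Node x W m)}"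
    have "finite X" by (rule finite_subset[OF _ fin_good]) (auto simp: X_def)
    have "c0 \<in> X" using \<open>good c0\<close> c0 v c(1) by (auto simp: X_def)
    \<comment> \<open>The rightmost grid point below \<open>v\<close> reached from
      \<open>c0\<close>. Were it still far from \<open>v\<close>, a further hop would contradict
      maximality.\<close>
    define x where "x = Max X"
    have "x \<in> X" unfolding x_def using \<open>finite X\<close> \<open>c0 \<in> X\<close> by (intro Max_in) auto
    then have x: "good x" "x < v" "chain V' m v (Node c0 W m) (Node x W m)"
      by (auto simp: X_def)
    \<comment> \<open>As \<open>2 * \<theta> d \<le> \<eta> (d / 2)\<close>, subtracting
      \<open>h / 8\<close> makes the inequality in \<open>hop\<close> strict.\<close>
    have stuck: False if y: "good y" "x < y" and d: "0 < d" "y + sz W - x \<le> 2 * \<theta> d - h / 8"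
      "d / 2 \<le> v - (y + sz W)" for y d
    proof -
      have "hop v (Node x W m) (Node y W m)"
        unfolding hop_def using d h \<theta>_le(2)[of d] \<eta>_mono[OF _ d(3)] by auto
      moreover have "Node y W m \<in> V'" using y by (auto simp: V'_def)
      ultimately have "chain V' m v (Node c0 W m) (Node y W m)"
        using x(3) by (auto intro: rtranclp.rtrancl_into_rtrancl)
      then have "y \<in> X" using y d szW by (auto simp: X_def)
      then have "y \<le> x" unfolding x_def using \<open>finite X\<close> by simp
      with y show False by simp
    qed
    have "v - x < K"
    proof (rule ccontr)
      assume far: "\<not> v - x < K"
      have hK: "16 * h \<le> K" using K \<theta>_le(1)[of K] by simp
      show False
      proof (cases "good (x + h)")
        case True
        show False
          by (rule stuck[OF True _ K(1)]) (use h hK K far szW in auto)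
      next
        case False
        obtain i :: nat where i: "x = c0 + of_nat i * h" using x(1) by (auto simp: good_def)
        have "\<exists>i'::nat. x + h = c0 + of_nat i' * h"
          by (rule exI[of _ "Suc i"]) (simp add: i algebra_simps)
        moreover have "x + h \<le> b" using far hK K(1) v(2) h by linarith
        ultimately obtain p where p: "p \<in> V" "pos p - h / 2 \<le> x + h" "x + h \<le> pos p + \<Lambda> p"
          using False unfolding good_def by (auto simp: not_less)
        define d where "d = v - pos p"
        have d: "0 < d" unfolding d_def using p(2) far hK h by linarith
        then have lt: "pos p < pos C" by (simp add: d_def v_def)
        have hd: "4 * h \<le> \<theta> d" "\<Lambda> p \<le> \<theta> d" "\<theta> d \<le> d / 4"
          using h_d[OF p(1) C lt] \<Lambda>_le[OF C lt] \<theta>_le(1)[of d] by (auto simp: d_def v_def)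
        \<comment> \<open>The old node \<open>p\<close> blocks the next grid point; \<open>y\<close>
          is the first grid point strictly beyond its forbidden zone.\<close>
        define i' where "i' = nat (\<lfloor>(pos p + \<Lambda> p - c0) / h\<rfloor> + 1)"
        define y where "y = c0 + of_nat i' * h"
        have "0 \<le> (pos p + \<Lambda> p - c0) / h"
          using p(3) good_ge[OF x(1)] h by (intro divide_nonneg_pos) linarith+
        then have i': "real i' = of_int \<lfloor>(pos p + \<Lambda> p - c0) / h\<rfloor> + 1"
          unfolding i'_def by simp
        have "(pos p + \<Lambda> p - c0) / h < real i'" "real i' \<le> (pos p + \<Lambda> p - c0) / h + 1"
          unfolding i' by linarith+
        then have y: "pos p + \<Lambda> p < y" "y \<le> pos p + \<Lambda> p + h"
          using h by (auto simp: y_def field_simps)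
        \<comment> \<open>Old nodes right of \<open>p\<close> are at least \<open>16 * h\<close> and
          \<open>4 * \<Lambda> p\<close> away from it; the zones of those left of \<open>p\<close>
          end before \<open>pos p\<close>.\<close>
        have "good y"
          unfolding good_def
        proof (intro conjI ballI)
          show "\<exists>i::nat. y = c0 + of_nat i * h" by (auto simp: y_def)
          show "y \<le> b" using y(2) hd d v(2) by (simp add: d_def)
          fix p' assume p': "p' \<in> V"
          consider "pos p' = pos p" | "pos p < pos p'" | "pos p' < pos p" by linarith
          then show "y < pos p' - h / 2 \<or> pos p' + \<Lambda> p' < y"
          proof cases
            case 1
            then have "p' = p" using inj p' p(1) by (auto dest: inj_onD)
            with y(1) show ?thesis by simp
          next
            case 2
            have "4 * h \<le> \<theta> (pos p' - pos p)" "\<Lambda> p \<le> \<theta> (pos p' - pos p)"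
              using h_d[OF p(1) p' 2] \<Lambda>_le[OF p' 2] by auto
            moreover define e where "e = \<theta> (pos p' - pos p)"
            moreover have "e \<le> (pos p' - pos p) / 4" unfolding e_def by (rule \<theta>_le)
            ultimately have "y < pos p' - h / 2" using y(2) 2 by argo
            then show ?thesis ..
          next
            case 3
            have "\<Lambda> p' \<le> \<theta> (pos p - pos p')" using \<Lambda>_le[OF p(1) 3] .
            with \<theta>_le(1)[of "pos p - pos p'"] y(1) 3 \<Lambda>_pos[of p]
            have "pos p' + \<Lambda> p' < y" by argo
            then show ?thesis ..
          qed
        qed
        show False
        proof (rule stuck[OF \<open>good y\<close> _ d])
          show "x < y" using p(3) y(1) h by linarith
          \<comment> \<open>The hop exceeds \<open>\<Lambda> p\<close> by less than
            \<open>3 * h\<close>: \<open>p\<close> is at most \<open>3 * h / 2\<close> right of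
            \<open>x\<close>, rounding costs \<open>h\<close>, and
            \<open>sz W < h / 4\<close>.\<close>
          show "y + sz W - x \<le> 2 * \<theta> d - h / 8" using y(2) p(2) hd szW h by linarith
          show "d / 2 \<le> v - (y + sz W)" using y(2) hd szW d h unfolding d_def by argo
        qed
      qed
    qed
    moreover have "Node c0 W m \<in> V'" using \<open>good c0\<close> by (auto simp: V'_def)
    moreover have "c0 + sz W \<le> \<theta> (pos C)"
      using \<theta>_mono[OF c(1) v(1)] h_c szW h unfolding c0_def v_def by linarith
    ultimately show ?thesis
      unfolding linked_def using x(3)
      by (intro exI[of _ "Node c0 W m"] exI[of _ "Node x W m"]) (auto simp: v_def K_def)
  qed
  moreover have "rank p = m \<and> \<theta> c / 2 \<le> pos p \<and> pos p \<le> b \<and> wid p \<le> M" if "p \<in> V' - V" for p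
    using that W(2) good_ge by (auto simp: V'_def c0_def) (auto simp: good_def)
  ultimately show ?thesis
    by (intro exI[of _ V']) (auto simp: V'_def)
qed

section \<open>Patterns of children with chains for all lower ranks\<close>

lemma pattern_aux:
  assumes "0 < a" and \<kappa>: "\<And>w. 0 < w \<Longrightarrow> 0 < \<kappa> w" and "j \<le> N"
  shows "\<exists>V. spaced (N - j) V \<and> (\<exists>C\<in>V. rank C = N) \<and>
    (\<forall>p\<in>V. ((\<lambda>x. \<theta> x / 2) ^^ j) (a / 2) \<le> pos p \<and> pos p \<le> a / 2 \<and> wid p \<le> a / 2 \<and>
       N - j \<le> rank p) \<and>
    (\<forall>C\<in>V. \<forall>m<rank C. N - j \<le> m \<longrightarrow> linked \<kappa> V C m)"
  using \<open>j \<le> N\<close>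
proof (induction j)
  case 0
  show ?case
    by (rule exI[of _ "{Node (a / 2) (min (a / 2) ((\<theta> ^^ N) 1)) N}"])
      (use \<open>0 < a\<close> funpow_\<theta>_pos[of 1 N] in \<open>auto simp: spaced_def\<close>)
next
  case (Suc j)
  define c where "c = ((\<lambda>x. \<theta> x / 2) ^^ j) (a / 2)"
  have "0 < ((\<lambda>x. \<theta> x / 2) ^^ i) (a / 2)" for i
    by (induction i) (use \<open>0 < a\<close> in \<open>auto intro: \<theta>_pos\<close>)
  then have c: "0 < c" by (simp add: c_def)
  \<comment> \<open>Ranks are inserted in decreasing order: when rank \<open>m\<close> is added, all
    nodes present have larger rank and get linked, and later insertions keep the links.\<close>
  define m where "m = N - Suc j"
  have Nj: "N - j = Suc m" using Suc.prems by (simp add: m_def)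
  from Suc obtain V where V: "spaced (Suc m) V" "\<exists>C\<in>V. rank C = N"
    "\<And>p. p \<in> V \<Longrightarrow> c \<le> pos p" "\<And>p. p \<in> V \<Longrightarrow> pos p \<le> a / 2" "\<And>p. p \<in> V \<Longrightarrow> wid p \<le> a / 2"
    "\<And>p. p \<in> V \<Longrightarrow> Suc m \<le> rank p"
    "\<And>C i. C \<in> V \<Longrightarrow> i < rank C \<Longrightarrow> Suc m \<le> i \<Longrightarrow> linked \<kappa> V C i"
    unfolding Nj c_def by auto
  have "V \<noteq> {}" using V(2) by auto
  have "0 < a / 2" using \<open>0 < a\<close> by simp
  from refine[where \<kappa> = \<kappa> and m = m, OF V(1) \<open>V \<noteq> {}\<close> c V(3) V(4) \<kappa> this]
  obtain V' where V': "V \<subseteq> V'" "spaced m V'"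
    "\<And>p. p \<in> V' - V \<Longrightarrow> rank p = m \<and> \<theta> c / 2 \<le> pos p \<and> pos p \<le> a / 2 \<and> wid p \<le> a / 2"
    "\<And>C. C \<in> V \<Longrightarrow> linked \<kappa> V' C m"
    by (metis (no_types, lifting))
  have "\<theta> c / 2 \<le> c" using \<theta>_le(1)[of c] c by simp
  have 1: "\<theta> c / 2 \<le> pos p \<and> pos p \<le> a / 2 \<and> wid p \<le> a / 2 \<and> m \<le> rank p" if "p \<in> V'" for p
    using V'(3)[of p] V(3-6)[of p] that \<open>\<theta> c / 2 \<le> c\<close> by (cases "p \<in> V") force+
  have 2: "linked \<kappa> V' C i" if "C \<in> V'" "i < rank C" "m \<le> i" for C i
  proof -
    have "C \<in> V" using V'(3)[of C] that by auto
    then show ?thesis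
      using V'(4)[of C] V(7)[of C i] that linked_mono[OF _ V'(1)] by (cases "i = m") auto
  qed
  show ?case
    unfolding m_def[symmetric]
    by (rule exI[of _ V']) (use V'(1,2) V(2) 1 2 in \<open>auto simp: c_def\<close>)
qed

text \<open>A lower bound for positions that depends neither on the pattern nor on
  \<open>\<kappa>\<close>, so that \<open>slack\<close> can be fixed before a pattern is
  chosen.\<close>

definition low :: "nat \<Rightarrow> real \<Rightarrow> real" where
  "low N a = ((\<lambda>x. \<theta> x / 2) ^^ N) (a / 2)"

lemma low_bounds: "0 < a \<Longrightarrow> 0 < low N a \<and> low N a \<le> a / 2"
proof (induction N)
  case (Suc N)
  then show ?case
    using \<theta>_pos[of "low N a"] \<theta>_le(1)[of "low N a"] by (simp add: low_def)
qed (simp add: low_def)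

definition pattern :: "nat \<Rightarrow> real \<Rightarrow> (real \<Rightarrow> real) \<Rightarrow> node set \<Rightarrow> bool" where
  "pattern N a \<kappa> V \<longleftrightarrow> finite V \<and> (\<exists>C\<in>V. rank C = N) \<and>
    (\<forall>p\<in>V. 0 < wid p \<and> wid p \<le> a / 2 \<and> low N a \<le> pos p \<and> pos p \<le> a / 2) \<and>
    (\<forall>p\<in>V. \<forall>q\<in>V. p = q \<or> pos p + wid p \<le> pos q \<or> pos q + wid q \<le> pos p) \<and>
    (\<forall>C\<in>V. \<forall>m<rank C. linked \<kappa> V C m)"

lemma pattern_exists:
  assumes "0 < a" "\<And>w. 0 < w \<Longrightarrow> 0 < \<kappa> w"
  shows "\<exists>V. pattern N a \<kappa> V"
proof -
  obtain V where V: "spaced 0 V" "\<exists>C\<in>V. rank C = N"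
    "\<And>p. p \<in> V \<Longrightarrow> low N a \<le> pos p \<and> pos p \<le> a / 2 \<and> wid p \<le> a / 2"
    "\<And>C m. C \<in> V \<Longrightarrow> m < rank C \<Longrightarrow> linked \<kappa> V C m"
    using pattern_aux[where \<kappa> = \<kappa>, OF assms order_refl, of N] by (auto simp: low_def)
  have "p = q \<or> pos p + wid p \<le> pos q \<or> pos q + wid q \<le> pos p" if "p \<in> V" "q \<in> V" for p q
  proof -
    consider "pos p = pos q" | "pos p < pos q" | "pos q < pos p" by linarith
    then show ?thesis
      using V(1) that unfolding spaced_def by cases (force dest: inj_onD)+
  qed
  with V show ?thesis
    unfolding pattern_def by (intro exI[of _ V]) (auto simp: spaced_def)
qed

section \<open>The tree of nodes and its Cantor set\<close>

text \<open>
  The children of a node \<open>C\<close> of width \<open>w\<close> lie at least \<open>low (Suc (Suc k)) (sz w)\<close> to the right of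
  \<open>pos C\<close>, so a chain that ends within \<open>slack k w\<close> of \<open>C\<close> can jump to the start of any chain inside \<open>C\<close>.
\<close>

definition slack :: "nat \<Rightarrow> real \<Rightarrow> real" where
  "slack k w = \<theta> (low (Suc (Suc k)) (sz w))"

lemma slack_pos: "0 < w \<Longrightarrow> 0 < slack k w"
  using low_bounds[OF sz_pos] \<theta>_pos by (simp add: slack_def)

lemma slack_le: "0 < w \<Longrightarrow> slack k w \<le> w"
  using low_bounds[OF sz_pos, of w "Suc (Suc k)"] \<theta>_le(1)[of "low (Suc (Suc k)) (sz w)"] sz_less[of w]
  by (simp add: slack_def)

text \<open>The rank \<open>Suc k\<close> occurs because stage \<open>n\<close> of the descent
  happens at a level at least \<open>n\<close> and needs a child of rank above
  \<open>n\<close>.\<close>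

definition pat :: "nat \<Rightarrow> real \<Rightarrow> node set" where
  "pat k w = (SOME V. pattern (Suc k) (sz w) (slack k) V)"

lemma pat: "0 < w \<Longrightarrow> pattern (Suc k) (sz w) (slack k) (pat k w)"
  unfolding pat_def by (rule someI_ex, rule pattern_exists) (auto intro: sz_pos slack_pos)

definition shift :: "real \<Rightarrow> node \<Rightarrow> node" where
  "shift t C = Node (t + pos C) (wid C) (rank C)"

lemma shift_simps [simp]: "pos (shift t C) = t + pos C" "wid (shift t C) = wid C" "rank (shift t C) = rank C"
  by (simp_all add: shift_def)

lemma chain_shift: "chain V m v p q \<Longrightarrow> chain (shift t ` V) m (t + v) (shift t p) (shift t q)"
proof (induction rule: rtranclp_induct)
  case (step q r)
  then have "shift t r \<in> shift t ` V \<and> rank (shift t r) = m \<and> hop (t + v) (shift t q) (shift t r)"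
    by (auto simp: hop_def algebra_simps)
  with step.IH show ?case by (rule rtranclp.rtrancl_into_rtrancl)
qed simp

definition kids :: "nat \<Rightarrow> node \<Rightarrow> node set" where
  "kids k P = shift (pos P) ` pat k (wid P)"

definition ivl :: "node \<Rightarrow> real set" where
  "ivl P = {pos P..pos P + sz (wid P)}"

lemma finite_kids: "0 < wid P \<Longrightarrow> finite (kids k P)"
  using pat[of "wid P" k] by (auto simp: kids_def pattern_def)

lemma kids_bounds:
  assumes "0 < wid P" "C \<in> kids k P"
  shows "0 < wid C" "wid C \<le> sz (wid P) / 2"
    "low (Suc k) (sz (wid P)) \<le> pos C - pos P" "pos C \<le> pos P + sz (wid P) / 2"
  using pat[OF assms(1), of k] assms(2) by (auto simp: kids_def pattern_def)

lemma kids_pos_less: "0 < wid P \<Longrightarrow> C \<in> kids k P \<Longrightarrow> pos P < pos C"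
  using kids_bounds(3)[of P C k] low_bounds[OF sz_pos, of "wid P" "Suc k"] by simp

lemma kids_wid: "0 < wid P \<Longrightarrow> C \<in> kids k P \<Longrightarrow> wid C \<le> wid P / 2"
  using kids_bounds(2)[of P C k] sz_less[of "wid P"] by simp

lemma kids_disjoint:
  assumes "0 < wid P" "C \<in> kids k P" "D \<in> kids k P"
  shows "C = D \<or> pos C + wid C \<le> pos D \<or> pos D + wid D \<le> pos C"
proof -
  obtain C' D' where *: "C' \<in> pat k (wid P)" "C = shift (pos P) C'"
    "D' \<in> pat k (wid P)" "D = shift (pos P) D'"
    using assms(2,3) by (auto simp: kids_def)
  then have "C' = D' \<or> pos C' + wid C' \<le> pos D' \<or> pos D' + wid D' \<le> pos C'"
    using pat[OF assms(1), of k] unfolding pattern_def by blast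
  with * show ?thesis by auto
qed

lemma kids_rank: "0 < wid P \<Longrightarrow> \<exists>C\<in>kids k P. rank C = Suc k"
  using pat[of "wid P" k] by (auto simp: kids_def pattern_def)

lemma ivl_kids:
  assumes "0 < wid P" "C \<in> kids k P"
  shows "ivl C \<subseteq> ivl P"
  using kids_bounds[OF assms] kids_pos_less[OF assms] sz_less[of "wid C"] by (auto simp: ivl_def)

lemma kids_linked:
  assumes "0 < wid P" "C \<in> kids k P" "m < rank C"
  obtains p q where "p \<in> kids k P" "rank p = m"
    "pos p + sz (wid p) \<le> pos P + \<theta> (pos C - pos P)"
    "chain (kids k P) m (pos C) p q" "pos C - pos q < slack k (wid C)"
proof -
  from assms(2) obtain D where D: "D \<in> pat k (wid P)" "C = shift (pos P) D"
    by (auto simp: kids_def)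
  then have "linked (slack k) (pat k (wid P)) D m"
    using pat[OF assms(1), of k] assms(3) by (auto simp: pattern_def)
  then obtain p q where "p \<in> pat k (wid P)" "rank p = m" "pos p + sz (wid p) \<le> \<theta> (pos D)"
    "chain (pat k (wid P)) m (pos D) p q" "pos D - pos q < slack k (wid D)"
    unfolding linked_def by blast
  with chain_shift[of "pat k (wid P)" m "pos D" p q "pos P"] D show thesis
    by (intro that[of "shift (pos P) p" "shift (pos P) q"]) (auto simp: kids_def)
qed

primrec level :: "real \<Rightarrow> nat \<Rightarrow> node set" where
  "level w 0 = {Node 0 w 0}"
| "level w (Suc k) = (\<Union>P\<in>level w k. kids k P)"

definition cantor :: "real \<Rightarrow> real set" where
  "cantor w = (\<Inter>k. \<Union>P\<in>level w k. ivl P)"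

lemma level_wid: "0 < w \<Longrightarrow> P \<in> level w k \<Longrightarrow> 0 < wid P \<and> wid P \<le> w / 2 ^ k"
proof (induction k arbitrary: P)
  case (Suc k)
  then obtain Q where Q: "Q \<in> level w k" "P \<in> kids k Q" by auto
  with Suc have "0 < wid Q" "wid Q \<le> w / 2 ^ k" by auto
  with kids_bounds(1)[OF _ Q(2)] kids_wid[OF _ Q(2)] have "0 < wid P" "wid P \<le> (w / 2 ^ k) / 2" by force+
  then show ?case by (simp add: mult.commute)
qed simp

lemma finite_level: "0 < w \<Longrightarrow> finite (level w k)"
  by (induction k) (auto intro: finite_kids dest: level_wid)

text \<open>A child, with its full width, ends before \<open>pos + wid\<close> of its parent, so
  disjointness is inherited.\<close>

lemma level_disjoint:
  assumes "0 < w"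
  shows "P \<in> level w k \<Longrightarrow> Q \<in> level w k \<Longrightarrow>
    P = Q \<or> pos P + wid P \<le> pos Q \<or> pos Q + wid Q \<le> pos P"
proof (induction k arbitrary: P Q)
  case (Suc k)
  then obtain P' Q' where *: "P' \<in> level w k" "P \<in> kids k P'" "Q' \<in> level w k" "Q \<in> kids k Q'"
    by auto
  have **: "0 < wid P'" "0 < wid Q'" using level_wid[OF assms] * by auto
  show ?case
  proof (cases "P' = Q'")
    case True
    with * ** show ?thesis using kids_disjoint by metis
  next
    case False
    with Suc.IH[OF *(1,3)] have "pos P' + wid P' \<le> pos Q' \<or> pos Q' + wid Q' \<le> pos P'" by simp
    moreover have "pos P + wid P < pos P' + wid P'"
      using kids_bounds[OF **(1) *(2)] sz_less[OF **(1)] **(1) by simp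
    moreover have "pos Q + wid Q < pos Q' + wid Q'"
      using kids_bounds[OF **(2) *(4)] sz_less[OF **(2)] **(2) by simp
    ultimately show ?thesis
      using kids_pos_less[OF **(1) *(2)] kids_pos_less[OF **(2) *(4)] by linarith
  qed
qed simp

lemma closed_cantor: "0 < w \<Longrightarrow> closed (cantor w)"
  unfolding cantor_def
  by (intro closed_INT ballI closed_UN) (auto simp: finite_level ivl_def)

text \<open>Take \<open>u = wid P\<close> for a node \<open>P\<close> of high level with
  \<open>x \<in> ivl P\<close>. The gap starts at or beyond the right end of \<open>ivl P\<close>
  and, as \<open>sz u < u / 2\<close>, ends before \<open>pos P + wid P\<close>, the earliest start
  of a later node of that level.\<close>

lemma cantor_gap:
  assumes "0 < w" "x \<in> cantor w" "0 < \<epsilon>"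
  shows "\<exists>u. 0 < u \<and> u < \<epsilon> \<and> u \<le> w \<and> {x + sz u<..<x + u / 2} \<inter> cantor w = {}"
proof -
  obtain k where k: "(1 / 2) ^ k < \<epsilon> / w"
    using real_arch_pow_inv[of "\<epsilon> / w" "1 / 2"] assms by auto
  obtain P where P: "P \<in> level w k" "x \<in> ivl P" using assms(2) unfolding cantor_def by blast
  have wP: "0 < wid P" "wid P \<le> w / 2 ^ k" using level_wid[OF assms(1) P(1)] by auto
  have "w / 2 ^ k \<le> w" using assms(1) by (simp add: field_simps)
  moreover have "w / 2 ^ k < \<epsilon>" using k assms(1) by (simp add: field_simps)
  moreover have False if y: "y \<in> {x + sz (wid P)<..<x + wid P / 2}" "y \<in> cantor w" for y
  proof -
    obtain Q where Q: "Q \<in> level w k" "y \<in> ivl Q" using y(2) unfolding cantor_def by blast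
    have "0 < wid Q" using level_wid[OF assms(1) Q(1)] by simp
    from level_disjoint[OF assms(1) P(1) Q(1)] show False
      using P(2) Q(2) y(1) sz_less[OF wP(1)] sz_less[OF \<open>0 < wid Q\<close>] wP(1) \<open>0 < wid Q\<close>
        sz_pos[OF wP(1)]
      by (auto simp: ivl_def)
  qed
  then have "{x + sz (wid P)<..<x + wid P / 2} \<inter> cantor w = {}" by blast
  ultimately show ?thesis using wP by (intro exI[of _ "wid P"]) auto
qed

section \<open>Descendants through high ranks, and jumps within a set\<close>

inductive desc :: "nat \<Rightarrow> nat \<Rightarrow> node \<Rightarrow> nat \<Rightarrow> node \<Rightarrow> bool" for n k P where
  desc_refl: "desc n k P k P"
| desc_step: "desc n k P l Q \<Longrightarrow> R \<in> kids l Q \<Longrightarrow> n \<le> rank R \<Longrightarrow> desc n k P (Suc l) R"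

lemma desc_trans: "desc n l Q m R \<Longrightarrow> desc n k P l Q \<Longrightarrow> desc n k P m R"
  by (induction rule: desc.induct) (auto intro: desc_step)

lemma desc_mono: "desc n k P l Q \<Longrightarrow> m \<le> n \<Longrightarrow> desc m k P l Q"
  by (induction rule: desc.induct) (auto intro: desc.intros)

lemma desc_level: "desc n k P l Q \<Longrightarrow> P \<in> level w k \<Longrightarrow> Q \<in> level w l"
  by (induction rule: desc.induct) auto

lemma desc_le: "desc n k P l Q \<Longrightarrow> k \<le> l"
  by (induction rule: desc.induct) auto

lemma desc_ivl: "desc n k P l Q \<Longrightarrow> 0 < wid P \<Longrightarrow> 0 < wid Q \<and> ivl Q \<subseteq> ivl P"
proof (induction rule: desc.induct)
  case (desc_step l Q R)
  then have "0 < wid Q" by simp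
  with desc_step kids_bounds(1)[OF this desc_step.hyps(2)] ivl_kids[OF this desc_step.hyps(2)]
  show ?case by blast
qed simp

text \<open>The version of \<open>hop\<close> for points, with target \<open>v\<close>. Only the
  landing point must lie in \<open>A\<close>, so a path may start anywhere.\<close>

definition jump :: "real set \<Rightarrow> real \<Rightarrow> real \<Rightarrow> real \<Rightarrow> bool" where
  "jump A v a b \<longleftrightarrow> b \<in> A \<and> b < v \<and> b - a < \<eta> (v - b)"

text \<open>A target further right increases the remaining distances and so the allowed lengths.
  Hence paths aimed at a node serve its descendants and the limit point.\<close>

lemma jumps_mono: "(jump A v)\<^sup>*\<^sup>* a b \<Longrightarrow> v \<le> v' \<Longrightarrow> (jump A v')\<^sup>*\<^sup>* a b"
proof (induction rule: rtranclp_induct)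
  case (step b c)
  then have "jump A v' b c"
    using \<eta>_mono[of "v - c" "v' - c"] by (auto simp: jump_def)
  with step show ?case by (auto intro: rtranclp.rtrancl_into_rtrancl)
qed simp

lemma chain_jumps:
  assumes "chain V n v p q" "\<And>r. r \<in> V \<Longrightarrow> rank r = n \<Longrightarrow> ivl r \<inter> A \<noteq> {}" "a \<in> ivl p"
  shows "\<exists>b\<in>ivl q. (jump A v)\<^sup>*\<^sup>* a b"
  using assms(1)
proof (induction rule: rtranclp_induct)
  case base
  then show ?case using assms(3) by auto
next
  case (step q r)
  then obtain b where b: "b \<in> ivl q" "(jump A v)\<^sup>*\<^sup>* a b" by blast
  from step.hyps(2) assms(2) obtain c where c: "c \<in> ivl r" "c \<in> A" by blast
  have r: "0 < v - (pos r + sz (wid r))"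
    "pos r + sz (wid r) - pos q < \<eta> (v - (pos r + sz (wid r)))"
    using step.hyps(2) by (auto simp: hop_def)
  have le: "c \<le> pos r + sz (wid r)" "pos q \<le> b" using b(1) c(1) by (auto simp: ivl_def)
  have "jump A v b c"
    using r le c(2) \<eta>_mono[OF r(1), of "v - c"] by (auto simp: jump_def)
  with b(2) have "(jump A v)\<^sup>*\<^sup>* a c" by (rule rtranclp.rtrancl_into_rtrancl)
  with c(1) show ?case by blast
qed

text \<open>Induction along the descent, with \<open>a\<close> fixed. For a child \<open>R\<close>
  of \<open>Q\<close> at offset \<open>off\<close>, the old path ends less than
  \<open>\<theta> off\<close> left of \<open>pos Q\<close>, and the rank \<open>n\<close> chain
  towards \<open>R\<close> starts at most \<open>\<theta> off\<close> right of it. The connecting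
  jump is shorter than \<open>2 * \<theta> off \<le> \<eta> (off / 2)\<close> and leaves a distance
  of at least \<open>off / 2\<close>.\<close>

lemma approach:
  assumes P: "0 < wid P" and C: "C \<in> kids k P" "n < rank C"
    and meet: "\<And>l Q. desc n k P l Q \<Longrightarrow> ivl Q \<inter> A \<noteq> {}"
  shows "\<exists>a<pos C. \<forall>l Q. desc (Suc n) (Suc k) C l Q \<longrightarrow>
    (\<exists>b. (jump A (pos Q))\<^sup>*\<^sup>* a b \<and> pos Q - b < slack (l - 1) (wid Q))"
proof -
  obtain p q where p: "p \<in> kids k P" "rank p = n"
    "pos p + sz (wid p) \<le> pos P + \<theta> (pos C - pos P)"
    and q: "chain (kids k P) n (pos C) p q" "pos C - pos q < slack k (wid C)"
    by (rule kids_linked[OF P C])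
  have kid: "ivl r \<inter> A \<noteq> {}" if "desc n k P l Q" "r \<in> kids l Q" "rank r = n" for l Q r
    using meet[OF desc_step[OF that(1,2)]] that(3) by simp
  obtain a where a: "a \<in> ivl p" using kid[OF desc_refl p(1,2)] by blast
  have wC: "0 < wid C" using kids_bounds[OF P C(1)] by simp
  have "a < pos C"
    using a p(3) kids_pos_less[OF P C(1)] \<theta>_le(1)[of "pos C - pos P"] by (auto simp: ivl_def)
  moreover have "\<exists>b. (jump A (pos Q))\<^sup>*\<^sup>* a b \<and> pos Q - b < slack (l - 1) (wid Q)"
    if "desc (Suc n) (Suc k) C l Q" for l Q
    using that
  proof (induction rule: desc.induct)
    case desc_refl
    from chain_jumps[OF q(1) kid[OF desc.desc_refl] a]
    obtain b where "b \<in> ivl q" "(jump A (pos C))\<^sup>*\<^sup>* a b" by blast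
    with q(2) show ?case by (intro exI[of _ b]) (auto simp: ivl_def)
  next
    case (desc_step l Q R)
    then obtain b where b: "(jump A (pos Q))\<^sup>*\<^sup>* a b" "pos Q - b < slack (l - 1) (wid Q)" by blast
    have wQ: "0 < wid Q" using desc_ivl[OF desc_step.hyps(1) wC] by simp
    have "desc n k P (Suc k) C"
      by (rule desc.desc_step[OF desc.desc_refl C(1)]) (use C(2) in simp)
    then have dQ: "desc n k P l Q"
      using desc_trans[OF desc_mono[OF desc_step.hyps(1), of n]] by simp
    \<comment> \<open>The slack of \<open>Q\<close> stems from its parent's level
      \<open>l - 1\<close>; \<open>l\<close> is positive since the descent starts at
      \<open>Suc k\<close>.\<close>
    have l: "Suc (Suc (l - 1)) = Suc l" using desc_le[OF desc_step.hyps(1)] by simp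
    define off where "off = pos R - pos Q"
    have off: "0 < off" "low (Suc l) (sz (wid Q)) \<le> off"
      using kids_bounds(3)[OF wQ desc_step.hyps(2)] kids_pos_less[OF wQ desc_step.hyps(2)]
      by (auto simp: off_def)
    have "slack (l - 1) (wid Q) \<le> \<theta> off"
      unfolding slack_def l by (rule \<theta>_mono) (use off low_bounds[OF sz_pos[OF wQ]] in auto)
    with b(2) have b_off: "pos Q - b < \<theta> off" by simp
    have "n < rank R" using desc_step.hyps(3) by simp
    then obtain p q where p: "p \<in> kids l Q" "rank p = n"
      "pos p + sz (wid p) \<le> pos Q + \<theta> (pos R - pos Q)"
      and q: "chain (kids l Q) n (pos R) p q" "pos R - pos q < slack l (wid R)"
      by (rule kids_linked[OF wQ desc_step.hyps(2)])
    obtain c where c: "c \<in> ivl p" "c \<in> A" using kid[OF dQ p(1,2)] by blast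
    have c_le: "c \<le> pos Q + \<theta> off" using c(1) p(3) by (auto simp: ivl_def off_def)
    have half: "off / 2 \<le> pos R - c"
      using c_le \<theta>_le(1)[of off] off(1) by (simp add: off_def)
    have bc: "jump A (pos R) b c"
      using c(2) c_le b_off \<theta>_le(2)[of off] \<eta>_mono[OF _ half] off(1) half
      by (auto simp: jump_def)
    have "(jump A (pos R))\<^sup>*\<^sup>* a b"
      by (rule jumps_mono[OF b(1)]) (use off in \<open>simp add: off_def\<close>)
    from this bc have ac: "(jump A (pos R))\<^sup>*\<^sup>* a c" by (rule rtranclp.rtrancl_into_rtrancl)
    from chain_jumps[OF q(1) kid[OF dQ] c(1)]
    obtain d where "d \<in> ivl q" "(jump A (pos R))\<^sup>*\<^sup>* c d" by blast
    with q(2) ac show ?case by (intro exI[of _ d]) (auto simp: ivl_def)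
  qed
  ultimately show ?thesis by blast
qed

section \<open>The category descent\<close>

lemma escape_point:
  fixes A :: "nat \<Rightarrow> real set"
  assumes w: "0 < w"
  shows "\<exists>x\<in>cantor w. \<forall>n. x \<in> A n \<longrightarrow>
    (\<exists>a<x. \<forall>\<epsilon>>0. \<exists>b. (jump (A n) x)\<^sup>*\<^sup>* a b \<and> x - b < \<epsilon>)"
proof -
  \<comment> \<open>The bound \<open>n \<le> fst s\<close> makes widths tend to 0 and gives the
    child of rank \<open>Suc (fst s)\<close> a rank above \<open>n\<close>.\<close>
  define good where "good n s \<longleftrightarrow> n \<le> fst s \<and> snd s \<in> level w (fst s)" for n :: nat and s
  define meets where "meets n s \<longleftrightarrow> (\<forall>l Q. desc n (fst s) (snd s) l Q \<longrightarrow> ivl Q \<inter> A n \<noteq> {})" for n s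
  define nxt where "nxt n s t \<longleftrightarrow> desc n (fst s) (snd s) (fst t) (snd t) \<and>
    (ivl (snd t) \<inter> A n = {} \<or> fst t = Suc (fst s) \<and> snd t \<in> kids (fst s) (snd s) \<and>
       n < rank (snd t) \<and> meets n s)" for n s t
  have "\<exists>s. \<forall>n. good n (s n) \<and> nxt n (s n) (s (Suc n))"
  proof (rule dependent_nat_choice)
    show "\<exists>s. good 0 s" by (rule exI[of _ "(0, Node 0 w 0)"]) (simp add: good_def)
  next
    fix s n assume s: "good n s"
    show "\<exists>t. good (Suc n) t \<and> nxt n s t"
    proof (cases "meets n s")
      case True
      have "0 < wid (snd s)" using s level_wid[OF w] by (auto simp: good_def)
      then obtain C where C: "C \<in> kids (fst s) (snd s)" "rank C = Suc (fst s)"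
        using kids_rank by blast
      have "desc n (fst s) (snd s) (Suc (fst s)) C"
        by (rule desc_step[OF desc_refl C(1)]) (use s C(2) in \<open>simp add: good_def\<close>)
      with C True s show ?thesis
        by (intro exI[of _ "(Suc (fst s), C)"]) (auto simp: good_def nxt_def)
    next
      case False
      then obtain l Q where Q: "desc n (fst s) (snd s) l Q" "ivl Q \<inter> A n = {}"
        by (auto simp: meets_def)
      have l: "n \<le> l" "Q \<in> level w l"
        using s desc_le[OF Q(1)] desc_level[OF Q(1)] by (auto simp: good_def)
      then have "0 < wid Q" using level_wid[OF w] by blast
      \<comment> \<open>One more step down, since the next stage requires a level of at least
        \<open>Suc n\<close>.\<close>
      then obtain C where C: "C \<in> kids l Q" "rank C = Suc l" using kids_rank by blast
      have "desc n (fst s) (snd s) (Suc l) C"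
        by (rule desc_step[OF Q(1) C(1)]) (use l C(2) in simp)
      moreover have "ivl C \<inter> A n = {}" using ivl_kids[OF \<open>0 < wid Q\<close> C(1)] Q(2) by blast
      ultimately show ?thesis
        using C l by (intro exI[of _ "(Suc l, C)"]) (auto simp: good_def nxt_def)
    qed
  qed
  then obtain s where s: "\<And>n. good n (s n)" "\<And>n. nxt n (s n) (s (Suc n))" by blast
  define K where "K n = fst (s n)" for n
  define P where "P n = snd (s n)" for n
  have K: "n \<le> K n" "P n \<in> level w (K n)" for n
    using s(1)[of n] by (auto simp: good_def K_def P_def)
  have wP: "0 < wid (P n)" "wid (P n) \<le> w / 2 ^ n" for n
  proof -
    show "0 < wid (P n)" using level_wid[OF w K(2)] by blast
    have "wid (P n) \<le> w / 2 ^ K n" using level_wid[OF w K(2)] by blast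
    also have "\<dots> \<le> w / 2 ^ n" using K(1)[of n] w by (intro divide_left_mono) auto
    finally show "wid (P n) \<le> w / 2 ^ n" .
  qed
  have desc: "desc n (K n) (P n) (K m) (P m)" if "n \<le> m" for n m
    using that
  proof (induction m rule: dec_induct)
    case (step m)
    have "desc m (K m) (P m) (K (Suc m)) (P (Suc m))"
      using s(2)[of m] by (simp add: nxt_def K_def P_def)
    then show ?case using desc_trans[OF desc_mono step.IH] step.hyps by simp
  qed (rule desc_refl)
  have "(\<Inter>n. ivl (P n)) \<noteq> {}"
    by (rule compact_nest)
      (use desc_ivl[OF desc wP(1)] less_imp_le[OF sz_pos[OF wP(1)]] in \<open>auto simp: ivl_def\<close>)
  then obtain x where x: "\<And>n. x \<in> ivl (P n)" by blast
  have "x \<in> cantor w"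
    unfolding cantor_def
  proof (rule INT_I)
    fix k
    have "(\<Union>P\<in>level w (Suc i). ivl P) \<subseteq> (\<Union>P\<in>level w i. ivl P)" for i
    proof
      fix y assume "y \<in> (\<Union>P\<in>level w (Suc i). ivl P)"
      then obtain P Q where PQ: "P \<in> level w i" "Q \<in> kids i P" "y \<in> ivl Q" by auto
      with level_wid[OF w PQ(1)] ivl_kids[of P Q i] show "y \<in> (\<Union>P\<in>level w i. ivl P)" by blast
    qed
    then have "decseq (\<lambda>i. \<Union>P\<in>level w i. ivl P)" by (rule decseq_SucI)
    from decseqD[OF this K(1)] show "x \<in> (\<Union>P\<in>level w k. ivl P)"
      using x[of k] K(2)[of k] by blast
  qed
  moreover have "\<exists>a<x. \<forall>\<epsilon>>0. \<exists>b. (jump (A n) x)\<^sup>*\<^sup>* a b \<and> x - b < \<epsilon>" if "x \<in> A n" for n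
  proof -
    \<comment> \<open>As \<open>x\<close> lies in \<open>A n\<close>, the first alternative of
      \<open>nxt\<close> is excluded.\<close>
    have "ivl (P (Suc n)) \<inter> A n \<noteq> {}" using that x by blast
    with s(2)[of n] have *: "K (Suc n) = Suc (K n)" "P (Suc n) \<in> kids (K n) (P n)"
      "n < rank (P (Suc n))" "\<And>l Q. desc n (K n) (P n) l Q \<Longrightarrow> ivl Q \<inter> A n \<noteq> {}"
      by (auto simp: nxt_def meets_def K_def P_def)
    have "\<exists>a<pos (P (Suc n)). \<forall>l Q. desc (Suc n) (Suc (K n)) (P (Suc n)) l Q \<longrightarrow>
      (\<exists>b. (jump (A n) (pos Q))\<^sup>*\<^sup>* a b \<and> pos Q - b < slack (l - 1) (wid Q))"
      by (rule approach[OF wP(1) *(2,3)]) (rule *(4))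
    then obtain a where a: "a < pos (P (Suc n))" "\<And>l Q. desc (Suc n) (Suc (K n)) (P (Suc n)) l Q \<Longrightarrow>
      \<exists>b. (jump (A n) (pos Q))\<^sup>*\<^sup>* a b \<and> pos Q - b < slack (l - 1) (wid Q)"
      by blast
    have "\<exists>b. (jump (A n) x)\<^sup>*\<^sup>* a b \<and> x - b < \<epsilon>" if "0 < \<epsilon>" for \<epsilon>
    proof -
      obtain i where i: "(1 / 2) ^ i < \<epsilon> / (2 * w)"
        using real_arch_pow_inv[of "\<epsilon> / (2 * w)" "1 / 2"] w \<open>0 < \<epsilon>\<close> by auto
      \<comment> \<open>Here \<open>i\<close> makes the width small, and \<open>Suc n\<close> makes
        \<open>P m\<close> a descendant of \<open>P (Suc n)\<close>.\<close>
      define m where "m = max i (Suc n)"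
      have "w / 2 ^ m \<le> w / 2 ^ i" using w by (intro divide_left_mono) (auto simp: m_def)
      also have "\<dots> < \<epsilon> / 2" using i w by (simp add: field_simps)
      finally have small: "wid (P m) < \<epsilon> / 2" using wP(2)[of m] by linarith
      obtain b where b: "(jump (A n) (pos (P m)))\<^sup>*\<^sup>* a b" "pos (P m) - b < slack (K m - 1) (wid (P m))"
        using a(2) desc[of "Suc n" m] *(1) by (auto simp: m_def)
      have "pos (P m) \<le> x" "x \<le> pos (P m) + wid (P m)"
        using x[of m] sz_less[OF wP(1)[of m]] wP(1)[of m] by (auto simp: ivl_def)
      moreover from this have "(jump (A n) x)\<^sup>*\<^sup>* a b" using jumps_mono[OF b(1)] by blast
      moreover have "pos (P m) - b < wid (P m)" using b(2) slack_le[OF wP(1)] by (rule less_le_trans)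
      ultimately have "(jump (A n) x)\<^sup>*\<^sup>* a b \<and> x - b < \<epsilon>" using small by auto
      then show ?thesis by blast
    qed
    moreover have "a < x" using a(1) x[of "Suc n"] by (auto simp: ivl_def)
    ultimately show ?thesis by blast
  qed
  ultimately show ?thesis by blast
qed

end

section \<open>From gaps and jumps to porosity, and the theorem\<close>

lemma strict_antimono_null_sequence:
  fixes Q :: "real \<Rightarrow> bool"
  assumes "\<And>\<epsilon>. 0 < \<epsilon> \<Longrightarrow> \<exists>\<alpha>. 0 < \<alpha> \<and> \<alpha> < \<epsilon> \<and> Q \<alpha>"
  obtains \<alpha> :: "nat \<Rightarrow> real" where "strict_antimono_on UNIV \<alpha>" "\<alpha> \<longlonglongrightarrow> 0" "\<And>n. 0 < \<alpha> n" "\<And>n. Q (\<alpha> n)"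
proof -
  have "\<exists>\<alpha>. \<forall>n::nat. (0 < \<alpha> n \<and> \<alpha> n < 1 / Suc n \<and> Q (\<alpha> n)) \<and> \<alpha> (Suc n) < \<alpha> n"
  proof (rule dependent_nat_choice)
    show "\<exists>x. 0 < x \<and> x < 1 / real (Suc 0) \<and> Q x" using assms[of 1] by simp
    fix x n assume "0 < x \<and> x < 1 / real (Suc n) \<and> Q x"
    then show "\<exists>y. (0 < y \<and> y < 1 / real (Suc (Suc n)) \<and> Q y) \<and> y < x"
      using assms[of "min x (1 / real (Suc (Suc n)))"] by auto
  qed
  then obtain \<alpha> where \<alpha>: "\<And>n. 0 < \<alpha> n" "\<And>n::nat. \<alpha> n < 1 / Suc n" "\<And>n. Q (\<alpha> n)" "\<And>n. \<alpha> (Suc n) < \<alpha> n"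
    by blast
  have "strict_antimono_on UNIV \<alpha>"
    using lift_Suc_mono_less[of "\<lambda>n. - \<alpha> n"] \<alpha>(4) by (auto simp: monotone_on_def)
  moreover have "\<alpha> \<longlonglongrightarrow> 0"
    by (rule tendsto_sandwich[OF _ _ tendsto_const LIMSEQ_inverse_real_of_nat])
      (use \<alpha>(1,2) less_imp_le in \<open>auto intro!: always_eventually simp: inverse_eq_divide\<close>)
  ultimately show thesis using that \<alpha> by blast
qed

text \<open>A path cannot cross a gap \<open>{x - y<..<x - f y}\<close> of \<open>A\<close>: going
  from \<open>b \<le> x - y\<close> to \<open>c \<ge> x - f y\<close> takes at least
  \<open>y - f y\<close>, which is at least \<open>\<eta> (x - c)\<close>. So it never passes
  \<open>x - y\<close>, although some path comes within \<open>f y\<close> of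
  \<open>x\<close>.\<close>

lemma (in hopping) not_left_porous_at:
  assumes "G3 \<delta> f" "0 < d" and f: "\<And>q y. 0 < q \<Longrightarrow> q \<le> y \<Longrightarrow> y \<le> d \<Longrightarrow> f y \<le> y - \<eta> q"
    and "a < x" and jumps: "\<And>\<epsilon>. 0 < \<epsilon> \<Longrightarrow> \<exists>b. (jump A x)\<^sup>*\<^sup>* a b \<and> x - b < \<epsilon>"
  shows "\<not> left_porous_at \<delta> f A x"
proof
  assume "left_porous_at \<delta> f A x"
  then obtain \<alpha> where \<alpha>: "strict_antimono_on UNIV \<alpha>" "range \<alpha> \<subseteq> {0..<\<delta>}" "\<alpha> \<longlonglongrightarrow> 0"
    "\<And>n. {x - \<alpha> n<..<x - f (\<alpha> n)} \<inter> A = {}"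
    unfolding left_porous_at_def by blast
  have "0 < min d (x - a)" using assms(2,4) by simp
  then have "\<forall>\<^sub>F n in sequentially. \<alpha> n < min d (x - a)" by (rule order_tendstoD(2)[OF \<alpha>(3)])
  then obtain n where n: "\<alpha> n < min d (x - a)" by (auto simp: eventually_sequentially)
  define y where "y = \<alpha> n"
  \<comment> \<open>The range only gives nonnegative values; strict decrease makes
    \<open>\<alpha> n\<close> positive.\<close>
  have "\<alpha> (Suc n) < \<alpha> n" using \<alpha>(1) by (simp add: monotone_on_def)
  moreover have "0 \<le> \<alpha> (Suc n)" "y < \<delta>" using \<alpha>(2) by (auto simp: y_def image_subset_iff)
  ultimately have y: "0 < y" "y < \<delta>" "y < d" "y < x - a" using n by (auto simp: y_def)
  then have fy: "0 < f y" "f y < y"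
    using assms(1) strict_mono_onD[of "{0..<\<delta>}" f 0 y] by (auto simp: G3_def G_def)
  obtain b where b: "(jump A x)\<^sup>*\<^sup>* a b" "x - b < f y" using jumps fy by blast
  from b(1) have "b \<le> x - y"
  proof (induction rule: rtranclp_induct)
    case base
    then show ?case using y by simp
  next
    case (step b c)
    show ?case
    proof (rule ccontr)
      assume "\<not> c \<le> x - y"
      moreover have c: "c \<in> A" "c < x" "c - b < \<eta> (x - c)" using step.hyps(2) by (auto simp: jump_def)
      moreover have "c \<notin> {x - y<..<x - f y}" using \<alpha>(4)[of n] c(1) unfolding y_def by blast
      ultimately have "x - f y \<le> c" by simp
      moreover from this have "f y \<le> y - \<eta> (x - c)" using c fy y by (intro f) auto
      ultimately show False using step.IH c(3) by linarith
    qed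
  qed
  with b(2) fy show False by linarith
qed

theorem theorem3p1:
  fixes f g :: "real \<Rightarrow> real" and \<delta>\<^sub>f \<delta>\<^sub>g :: real
  assumes "G3 \<delta>\<^sub>f f" and "G3 \<delta>\<^sub>g g"
  shows "\<exists>F :: real set. closed F \<and> right_porous \<delta>\<^sub>g g F \<and> \<not> sigma_left_porous \<delta>\<^sub>f f F"
proof -
  have f: "0 < \<delta>\<^sub>f" "continuous_on {0..<\<delta>\<^sub>f} f" "\<And>x. 0 < x \<Longrightarrow> x < \<delta>\<^sub>f \<Longrightarrow> f x < x"
    using assms(1) by (auto simp: G3_def G_def)
  have g: "0 < \<delta>\<^sub>g" "\<And>x. 0 < x \<Longrightarrow> x < \<delta>\<^sub>g \<Longrightarrow> g x < x" "\<And>x. 0 < x \<Longrightarrow> x < \<delta>\<^sub>g \<Longrightarrow> 0 < g x"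
    using assms(2) strict_mono_onD[of "{0..<\<delta>\<^sub>g}" g 0] by (auto simp: G3_def G_def)
  \<comment> \<open>Halving keeps \<open>{min q d..d}\<close> compact inside the domain of
    \<open>f\<close>, so the infimum \<open>\<eta> q\<close> is attained and positive.\<close>
  define d where "d = \<delta>\<^sub>f / 2"
  have d: "0 < d" "d < \<delta>\<^sub>f" using f(1) by (auto simp: d_def)
  \<comment> \<open>The \<open>min\<close> keeps the interval nonempty when
    \<open>q > d\<close>.\<close>
  define I where "I q = (\<lambda>y. y - f y) ` {min q d..d}" for q
  define \<eta> where "\<eta> q = Inf (I q)" for q
  have I: "I q \<noteq> {}" "bdd_below (I q)" "\<eta> q \<in> I q" if "0 < q" for q
  proof -
    have "continuous_on {min q d..d} (\<lambda>y. y - f y)"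
      by (intro continuous_intros continuous_on_subset[OF f(2)]) (use that d in auto)
    then have "compact (I q)" unfolding I_def by (intro compact_continuous_image) auto
    then show "I q \<noteq> {}" "bdd_below (I q)" "\<eta> q \<in> I q"
      using closed_contains_Inf[of "I q"] bounded_imp_bdd_below[of "I q"]
      by (auto simp: I_def \<eta>_def compact_imp_bounded compact_imp_closed)
  qed
  \<comment> \<open>With \<open>\<alpha> = u / 2\<close>, \<open>cantor_gap\<close> yields
    \<open>{x + g \<alpha><..<x + \<alpha>}\<close>. The value \<open>u / 4\<close> is a filler
    beyond the domain of \<open>g\<close>; the tree only has widths up to
    \<open>\<delta>\<^sub>g\<close>.\<close>
  define sz where "sz u = (if u / 2 < \<delta>\<^sub>g then g (u / 2) else u / 4)" for u
  interpret hopping \<eta> sz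
  proof
    show "0 < \<eta> q" if "0 < q" for q
      using I(3)[OF that] f(3) d that by (auto simp: I_def)
    show "\<eta> q \<le> \<eta> q'" if "0 < q" "q \<le> q'" for q q'
      unfolding \<eta>_def using I[of q] I[of q'] that by (intro cInf_superset_mono) (auto simp: I_def)
    show "0 < sz u" "sz u < u / 2" if "0 < u" for u
      using g(2,3)[of "u / 2"] that by (auto simp: sz_def)
  qed
  have f_le: "f y \<le> y - \<eta> q" if "0 < q" "q \<le> y" "y \<le> d" for q y
  proof -
    have "\<eta> q \<le> y - f y"
      unfolding \<eta>_def using I(2)[OF that(1)] that by (intro cInf_lower) (auto simp: I_def)
    then show ?thesis by simp
  qed
  have "right_porous_at \<delta>\<^sub>g g (cantor \<delta>\<^sub>g) x" if x: "x \<in> cantor \<delta>\<^sub>g" for x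
  proof -
    have "\<exists>\<alpha>. 0 < \<alpha> \<and> \<alpha> < \<epsilon> \<and> \<alpha> < \<delta>\<^sub>g \<and> {x + g \<alpha><..<x + \<alpha>} \<inter> cantor \<delta>\<^sub>g = {}"
      if \<epsilon>: "0 < \<epsilon>" for \<epsilon>
    proof -
      obtain u where u: "0 < u" "u < \<epsilon>" "u \<le> \<delta>\<^sub>g" "{x + sz u<..<x + u / 2} \<inter> cantor \<delta>\<^sub>g = {}"
        using cantor_gap[OF g(1) x \<epsilon>] by blast
      then have "sz u = g (u / 2)" by (simp add: sz_def)
      with u show ?thesis by (intro exI[of _ "u / 2"]) auto
    qed
    then obtain \<alpha> :: "nat \<Rightarrow> real" where "strict_antimono_on UNIV \<alpha>" "\<alpha> \<longlonglongrightarrow> 0" "\<And>n. 0 < \<alpha> n"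
      "\<And>n. \<alpha> n < \<delta>\<^sub>g \<and> {x + g (\<alpha> n)<..<x + \<alpha> n} \<inter> cantor \<delta>\<^sub>g = {}"
      using strict_antimono_null_sequence
        [where Q = "\<lambda>\<alpha>. \<alpha> < \<delta>\<^sub>g \<and> {x + g \<alpha><..<x + \<alpha>} \<inter> cantor \<delta>\<^sub>g = {}"] by metis
    then show ?thesis
      unfolding right_porous_at_def by (intro exI[of _ \<alpha>]) (auto simp: less_imp_le)
  qed
  moreover have "\<not> sigma_left_porous \<delta>\<^sub>f f (cantor \<delta>\<^sub>g)"
  proof
    assume "sigma_left_porous \<delta>\<^sub>f f (cantor \<delta>\<^sub>g)"
    then obtain \<A> where \<A>: "countable \<A>" "\<And>A. A \<in> \<A> \<Longrightarrow> left_porous \<delta>\<^sub>f f A" "cantor \<delta>\<^sub>g = \<Union>\<A>"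
      unfolding sigma_left_porous_def by blast
    \<comment> \<open>Nonemptiness is what makes \<open>from_nat_into\<close> enumerate exactly
      \<open>\<A>\<close>.\<close>
    have "cantor \<delta>\<^sub>g \<noteq> {}" using escape_point[OF g(1)] by blast
    with \<A>(3) have "\<A> \<noteq> {}" by auto
    then have range: "range (from_nat_into \<A>) = \<A>" using \<A>(1) by (rule range_from_nat_into)
    obtain x where x: "x \<in> cantor \<delta>\<^sub>g" "\<And>n. x \<in> from_nat_into \<A> n \<Longrightarrow>
      \<exists>a<x. \<forall>\<epsilon>>0. \<exists>b. (jump (from_nat_into \<A> n) x)\<^sup>*\<^sup>* a b \<and> x - b < \<epsilon>"
      using escape_point[OF g(1), of "from_nat_into \<A>"] by blast
    from x(1) \<A>(3) range obtain n where n: "x \<in> from_nat_into \<A> n" by blast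
    then have "left_porous_at \<delta>\<^sub>f f (from_nat_into \<A> n) x"
      using \<A>(2) range unfolding left_porous_def by blast
    with x(2)[OF n] not_left_porous_at[OF assms(1) d(1) f_le] show False by blast
  qed
  ultimately show ?thesis
    using closed_cantor[OF g(1)] unfolding right_porous_def by blast
qed

end
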